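(* For every inner function $\varphi:\mathbb{D}\to\mathbb{D}$ there is a weight $w\in H^2$ such that the weighted composition operator $T_{w,\varphi}$ is an isometry on $H^2$.
   Context: $\mathbb{D}$ is the open unit disc and $H^2$ the Hardy space of the disc. The weighted composition operator is $(T_{w,\varphi}f)(z)=w(z)f(\varphi(z))$ for $f\in H^2$, $z\in\mathbb{D}$. An isometry is a linear operator $T$ with $\|Tf\|=\|f\|$ for all $f$ (not necessarily surjective). *)

theory Defs
  imports "HOL-Complex_Analysis.Complex_Analysis"
begin

abbreviation unit_disc :: "complex set"  (\<open>\<D>\<close>)
  where "\<D> \<equiv> ball 0 1"

text \<open>Functions on the disc are total functions of which only the values on \<open>\<D>\<close> matter;
  two of them represent the same element of the Hardy space iff they agree on \<open>\<D>\<close>.\<close>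

definition integral_mean2 :: "(complex \<Rightarrow> complex) \<Rightarrow> real \<Rightarrow> real"
  where "integral_mean2 f r =
    (1 / (2 * pi)) * (LINT t|lebesgue_on {0..2*pi}. (cmod (f (of_real r * cis t)))\<^sup>2)"

definition hardy2 :: "(complex \<Rightarrow> complex) set"
  where "hardy2 = {f. f holomorphic_on \<D> \<and> bdd_above (integral_mean2 f ` {0..<1})}"

definition hardy2_norm :: "(complex \<Rightarrow> complex) \<Rightarrow> real"
  where "hardy2_norm f = sqrt (SUP r\<in>{0..<1}. integral_mean2 f r)"

text \<open>Unimodular constants count as inner here; they are excluded by requiring
  in addition that the function maps \<open>\<D>\<close> into \<open>\<D>\<close>.\<close>

definition inner_function :: "(complex \<Rightarrow> complex) \<Rightarrow> bool"
  where "inner_function \<phi> \<longleftrightarrow>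
    \<phi> holomorphic_on \<D> \<and> (\<forall>z\<in>\<D>. cmod (\<phi> z) \<le> 1) \<and>
    (AE t in lebesgue_on {0..2*pi}.
      \<exists>l. ((\<lambda>r. \<phi> (of_real r * cis t)) \<longlongrightarrow> l) (at_left 1) \<and> cmod l = 1)"

definition weighted_comp ::
    "(complex \<Rightarrow> complex) \<Rightarrow> (complex \<Rightarrow> complex) \<Rightarrow> (complex \<Rightarrow> complex) \<Rightarrow> complex \<Rightarrow> complex"
  where "weighted_comp w \<phi> f = (\<lambda>z. w z * f (\<phi> z))"

definition hardy2_isometry :: "((complex \<Rightarrow> complex) \<Rightarrow> complex \<Rightarrow> complex) \<Rightarrow> bool"
  where "hardy2_isometry T \<longleftrightarrow>
    (\<forall>f\<in>hardy2. T f \<in> hardy2) \<and>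
    (\<forall>f\<in>hardy2. \<forall>g\<in>hardy2. \<forall>z\<in>\<D>. T (\<lambda>x. f x + g x) z = T f z + T g z) \<and>
    (\<forall>c. \<forall>f\<in>hardy2. \<forall>z\<in>\<D>. T (\<lambda>x. c * f x) z = c * T f z) \<and>
    (\<forall>f\<in>hardy2. hardy2_norm (T f) = hardy2_norm f)"

end

theory Submission
  imports Defs
begin

text \<open>Put \<open>a = \<phi> 0\<close> and \<open>s = 1 - |a|\<^sup>2\<close>. The push-forward of normalised arc length under the boundary
  values of \<open>\<phi>\<close> has density the Poisson kernel of \<open>a\<close>, so the weight should satisfy
  \<open>|w|\<^sup>2 = |1 - cnj a * \<phi>|\<^sup>2 / s\<close> on the circle, and \<open>w = (1 - cnj a * \<phi>) / sqrt s\<close> does.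
  To avoid boundary measures, the norm identity is proved first for polynomials, by induction on the degree:
  for a polynomial \<open>b + u * q u\<close> the function \<open>|w * (b + \<phi> * q \<phi>)|\<^sup>2\<close> differs from \<open>|w * q \<phi>|\<^sup>2\<close> by the
  real part of a holomorphic function with value \<open>|b|\<^sup>2\<close> at \<open>0\<close> and a bounded multiple of
  \<open>1 - |\<phi>|\<^sup>2\<close>, whose circle means tend to \<open>0\<close> because \<open>\<phi>\<close> is inner. Taylor polynomials and Parseval's
  identity then give the general case.\<close>

section \<open>Means over circles and their limits\<close>

definition circle_mean :: "(complex \<Rightarrow> real) \<Rightarrow> real \<Rightarrow> real"
  where "circle_mean u r = (1 / (2 * pi)) * (LINT t|lebesgue_on {0..2*pi}. u (of_real r * cis t))"

text \<open>Coefficients are a sequence rather than a polynomial object, so that dividing off the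
  constant term is the shift \<open>c \<circ> Suc\<close> and inductions can generalise over
  \<open>c\<close>.\<close>

definition partial_sum :: "(nat \<Rightarrow> complex) \<Rightarrow> nat \<Rightarrow> complex \<Rightarrow> complex"
  where "partial_sum c n z = (\<Sum>k<n. c k * z ^ k)"

lemma integral_mean2_eq_circle_mean: "integral_mean2 f r = circle_mean (\<lambda>z. (cmod (f z))\<^sup>2) r"
  by (simp add: integral_mean2_def circle_mean_def)

lemma circle_in_disc: "0 \<le> r \<Longrightarrow> r < 1 \<Longrightarrow> of_real r * cis t \<in> \<D>"
  by (simp add: norm_mult)

lemma continuous_on_circle:
  assumes "continuous_on \<D> u" "0 \<le> r" "r < 1"
  shows "continuous_on A (\<lambda>t. u (of_real r * cis t))"
  by (rule continuous_on_compose2[OF assms(1)])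
     (use circle_in_disc assms in \<open>auto intro!: continuous_intros\<close>)

lemma integrable_circle:
  fixes u :: "complex \<Rightarrow> 'a::euclidean_space"
  assumes "continuous_on \<D> u" "0 \<le> r" "r < 1"
  shows "integrable (lebesgue_on {0..2*pi}) (\<lambda>t. u (of_real r * cis t))"
  by (intro continuous_imp_integrable_real continuous_on_circle assms)

lemma circle_mean_add:
  assumes "continuous_on \<D> u" "continuous_on \<D> v" "0 \<le> r" "r < 1"
  shows "circle_mean (\<lambda>z. u z + v z) r = circle_mean u r + circle_mean v r"
  unfolding circle_mean_def
  by (subst Bochner_Integration.integral_add)
     (auto intro!: integrable_circle assms simp: distrib_left simp flip: add_divide_distrib)

lemma circle_mean_cmult: "circle_mean (\<lambda>z. k * u z) r = k * circle_mean u r"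
  by (simp add: circle_mean_def)

lemma circle_mean_mono:
  assumes "continuous_on \<D> u" "continuous_on \<D> v" "0 \<le> r" "r < 1"
    and "\<And>z. z \<in> \<D> \<Longrightarrow> u z \<le> v z"
  shows "circle_mean u r \<le> circle_mean v r"
  unfolding circle_mean_def
  by (intro mult_left_mono integral_mono integrable_circle assms circle_in_disc) auto

text \<open>Mean value property, from Cauchy's integral formula at the centre of the circle. The
  degenerate circle \<open>r = 0\<close> is separate because the Cauchy integrand divides by the
  point of the circle.\<close>

lemma circle_mean_Re_holomorphic:
  assumes hol: "h holomorphic_on \<D>" and r: "0 \<le> r" "r < 1"
  shows "circle_mean (\<lambda>z. Re (h z)) r = Re (h 0)"
proof (cases "r = 0")
  case True
  then show ?thesis by (simp add: circle_mean_def measure_restrict_space)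
next
  case False
  then have "r > 0" using r by simp
  have "cball 0 r \<subseteq> \<D>" using r by auto
  then have "h holomorphic_on cball 0 r"
    using hol holomorphic_on_subset by blast
  then have "((\<lambda>u. h u / (u - 0)) has_contour_integral (2 * of_real pi * \<i> * h 0)) (circlepath 0 r)"
    by (rule Cauchy_integral_circlepath_simple) (use \<open>r > 0\<close> in auto)
  then have "((\<lambda>t. h (0 + r * cis t) / (0 + r * cis t - 0) * r * \<i> * cis t) has_integral
               (2 * of_real pi * \<i> * h 0)) {0..2*pi}"
    unfolding circlepath_def by (subst (asm) has_contour_integral_part_circlepath_iff) auto
  then have "((\<lambda>t. \<i> * h (r * cis t)) has_integral \<i> * (2 * of_real pi * h 0)) {0..2*pi}"
    using False by (simp add: divide_simps mult_ac)
  then have "((\<lambda>t. - \<i> * (\<i> * h (r * cis t))) has_integral - \<i> * (\<i> * (2 * of_real pi * h 0))) {0..2*pi}"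
    by (rule has_integral_mult_right)
  then have "((\<lambda>t. h (r * cis t)) has_integral (2 * of_real pi * h 0)) {0..2*pi}"
    by simp
  then have "((\<lambda>t. Re (h (r * cis t))) has_integral Re (2 * of_real pi * h 0)) {0..2*pi}"
    by (rule has_integral_linear[OF _ bounded_linear_Re, unfolded o_def])
  moreover have "integrable (lebesgue_on {0..2*pi}) (\<lambda>t. Re (h (of_real r * cis t)))"
    by (rule integrable_circle[where u = "\<lambda>z. Re (h z)"])
       (use r hol in \<open>auto intro!: continuous_intros holomorphic_on_imp_continuous_on\<close>)
  ultimately show ?thesis
    unfolding circle_mean_def by (simp add: lebesgue_integral_eq_integral integral_unique)
qed

lemma circle_mean_const: "0 \<le> r \<Longrightarrow> r < 1 \<Longrightarrow> circle_mean (\<lambda>z. k) r = k"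
  using circle_mean_Re_holomorphic[of "\<lambda>z. of_real k" r] by simp

text \<open>Dominated convergence. The radii may vary with \<open>n\<close>, so it covers both
  approximation on a fixed circle and circles growing towards the boundary.\<close>

lemma circle_mean_tendsto:
  assumes "\<And>n. continuous_on \<D> (u n)" "continuous_on \<D> v"
    and R: "\<And>n. 0 \<le> R n" "\<And>n. R n < 1" and r: "0 \<le> r" "r < 1"
    and "\<And>n t. \<bar>u n (of_real (R n) * cis t)\<bar> \<le> B"
    and "AE t in lebesgue_on {0..2*pi}. (\<lambda>n. u n (of_real (R n) * cis t)) \<longlonglongrightarrow> v (of_real r * cis t)"
  shows "(\<lambda>n. circle_mean (u n) (R n)) \<longlonglongrightarrow> circle_mean v r"
  unfolding circle_mean_def
proof (intro tendsto_mult tendsto_const integral_dominated_convergence[where w = "\<lambda>_. B"])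
  show "(\<lambda>t. u n (of_real (R n) * cis t)) \<in> borel_measurable (lebesgue_on {0..2*pi})" for n
    using integrable_circle[OF assms(1) R] by (rule borel_measurable_integrable)
  show "(\<lambda>t. v (of_real r * cis t)) \<in> borel_measurable (lebesgue_on {0..2*pi})"
    using integrable_circle[OF assms(2) r] by (rule borel_measurable_integrable)
qed (use assms in auto)

lemma circle_mean_norm_tendsto:
  fixes F :: "nat \<Rightarrow> complex \<Rightarrow> complex"
  assumes "\<And>n. continuous_on \<D> (F n)" "continuous_on \<D> G" and r: "0 \<le> r" "r < 1"
    and B: "\<And>n z. norm z = r \<Longrightarrow> norm (F n z) \<le> B"
    and lim: "\<And>z. norm z = r \<Longrightarrow> (\<lambda>n. F n z) \<longlonglongrightarrow> G z"
  shows "(\<lambda>n. integral_mean2 (F n) r) \<longlonglongrightarrow> integral_mean2 G r"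
  unfolding integral_mean2_eq_circle_mean
proof (rule circle_mean_tendsto[where B = "B\<^sup>2"])
  have n: "norm (of_real r * cis t) = r" for t using r by (simp add: norm_mult)
  show "\<bar>(cmod (F n (of_real r * cis t)))\<^sup>2\<bar> \<le> B\<^sup>2" for n t
    using B[OF n] by (simp add: power_mono)
  show "AE t in lebesgue_on {0..2*pi}. (\<lambda>i. (cmod (F i (of_real r * cis t)))\<^sup>2) \<longlonglongrightarrow> (cmod (G (of_real r * cis t)))\<^sup>2"
    using lim[OF n] by (intro AE_I2 tendsto_intros)
qed (intro continuous_on_power continuous_on_norm assms)+

section \<open>Polynomials, Parseval's identity and Taylor coefficients\<close>

lemma partial_sum_0 [simp]: "partial_sum c 0 z = 0"
  by (simp add: partial_sum_def)

lemma partial_sum_Suc: "partial_sum c (Suc n) z = c 0 + z * partial_sum (c \<circ> Suc) n z"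
  unfolding partial_sum_def by (subst sum.lessThan_Suc_shift) (simp add: sum_distrib_left mult_ac)

lemma holomorphic_on_partial_sum [holomorphic_intros]:
  "f holomorphic_on A \<Longrightarrow> (\<lambda>z. partial_sum c n (f z)) holomorphic_on A"
  unfolding partial_sum_def by (intro holomorphic_intros)

lemma norm_partial_sum_le:
  assumes "norm z \<le> x" "summable (\<lambda>k. norm (c k) * x ^ k)" "0 \<le> x"
  shows "norm (partial_sum c n z) \<le> (\<Sum>k. norm (c k) * x ^ k)"
proof -
  have "norm (partial_sum c n z) \<le> (\<Sum>k<n. norm (c k) * x ^ k)"
    unfolding partial_sum_def
    by (rule sum_norm_le) (simp add: norm_mult norm_power assms mult_left_mono power_mono)
  also have "\<dots> \<le> (\<Sum>k. norm (c k) * x ^ k)"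
    using assms by (intro sum_le_suminf) auto
  finally show ?thesis .
qed

lemma cmod_add_squared: "(cmod (a + b))\<^sup>2 = (cmod a)\<^sup>2 + (cmod b)\<^sup>2 + 2 * Re (cnj a * b)"
  unfolding cmod_power2 by (simp add: power2_eq_square algebra_simps)

text \<open>A pointwise substitute for the triangle inequality in L^2: it can be integrated term by
  term, and the factor \<open>1 + \<epsilon>\<close> is as close to 1 as desired.\<close>

lemma cmod_diff_squared_le:
  assumes "\<epsilon> > 0"
  shows "(cmod (a - b))\<^sup>2 \<le> (1 + \<epsilon>) * (cmod a)\<^sup>2 + (1 + 1 / \<epsilon>) * (cmod b)\<^sup>2"
proof -
  let ?x = "cmod a" and ?y = "cmod b"
  have "(cmod (a - b))\<^sup>2 \<le> (?x + ?y)\<^sup>2"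
    by (intro power_mono norm_triangle_ineq4 norm_ge_zero)
  \<comment> \<open>Completing the square: the cross term \<open>2 * ?x * ?y\<close> is absorbed at
    the cost of a nonnegative square.\<close>
  also have "\<dots> = (1 + \<epsilon>) * ?x\<^sup>2 + (1 + 1 / \<epsilon>) * ?y\<^sup>2 - (\<epsilon> * ?x - ?y)\<^sup>2 / \<epsilon>"
    using assms by (simp add: field_simps power2_eq_square)
  also have "\<dots> \<le> (1 + \<epsilon>) * ?x\<^sup>2 + (1 + 1 / \<epsilon>) * ?y\<^sup>2"
    using assms by simp
  finally show ?thesis .
qed

text \<open>Induction on the constant term replaces orthogonality integrals: the cross term between
  \<open>c 0\<close> and \<open>z * q z\<close> is the real part of a holomorphic function vanishing
  at 0, so its mean is 0.\<close>

lemma integral_mean2_partial_sum: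
  assumes r: "0 \<le> r" "r < 1"
  shows "integral_mean2 (partial_sum c n) r = (\<Sum>k<n. (norm (c k))\<^sup>2 * r ^ (2 * k))"
proof (induction n arbitrary: c)
  case 0
  then show ?case by (simp add: integral_mean2_def)
next
  case (Suc n)
  let ?q = "partial_sum (c \<circ> Suc) n"
  define h where "h z = of_real ((norm (c 0))\<^sup>2) + 2 * cnj (c 0) * (z * ?q z)" for z
  have h: "h holomorphic_on \<D>" unfolding h_def by (intro holomorphic_intros)
  have q: "continuous_on \<D> ?q"
    by (intro holomorphic_on_imp_continuous_on holomorphic_intros)
  have n: "norm (of_real r * cis t) = r" for t using r by (simp add: norm_mult)
  have eq: "(norm (partial_sum c (Suc n) z))\<^sup>2 = Re (h z) + (norm z)\<^sup>2 * (norm (?q z))\<^sup>2" for z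
    unfolding partial_sum_Suc cmod_add_squared h_def
    by (simp add: norm_mult power_mult_distrib mult.assoc)
  have "integral_mean2 (partial_sum c (Suc n)) r = circle_mean (\<lambda>z. Re (h z) + (norm z)\<^sup>2 * (norm (?q z))\<^sup>2) r"
    by (simp only: integral_mean2_eq_circle_mean eq)
  \<comment> \<open>The factor \<open>norm z\<close> is constant on the circle, so it can be pulled
    out of the mean.\<close>
  also have "\<dots> = circle_mean (\<lambda>z. Re (h z) + r\<^sup>2 * (norm (?q z))\<^sup>2) r"
    unfolding circle_mean_def n ..
  also have "\<dots> = Re (h 0) + r\<^sup>2 * integral_mean2 ?q r"
    using h q r by (subst circle_mean_add)
      (auto intro!: continuous_intros holomorphic_on_imp_continuous_on
         simp: circle_mean_cmult circle_mean_Re_holomorphic integral_mean2_eq_circle_mean)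
  also have "\<dots> = (\<Sum>k<Suc n. (norm (c k))\<^sup>2 * r ^ (2 * k))"
    unfolding Suc.IH by (subst sum.lessThan_Suc_shift)
      (simp add: h_def sum_distrib_left power_add power_mult mult_ac power2_eq_square)
  finally show ?case .
qed

lemma holomorphic_disc_power_series:
  assumes "f holomorphic_on \<D>"
  obtains c where "\<And>z. z \<in> \<D> \<Longrightarrow> (\<lambda>n. partial_sum c n z) \<longlonglongrightarrow> f z"
    and "\<And>x. 0 \<le> x \<Longrightarrow> x < 1 \<Longrightarrow> summable (\<lambda>k. norm (c k) * x ^ k)"
proof
  define c where "c n = (deriv ^^ n) f 0 / fact n" for n
  have s: "(\<lambda>n. c n * z ^ n) sums f z" if "z \<in> \<D>" for z
    using holomorphic_power_series[OF assms that] by (simp add: c_def)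
  then show "(\<lambda>n. partial_sum c n z) \<longlonglongrightarrow> f z" if "z \<in> \<D>" for z
    using that by (simp add: partial_sum_def sums_def)
  show "summable (\<lambda>k. norm (c k) * x ^ k)" if x: "0 \<le> x" "x < 1" for x
  proof -
    \<comment> \<open>Convergence at the midpoint between \<open>x\<close> and 1, still inside the
      disc, forces absolute convergence at the smaller radius \<open>x\<close>.\<close>
    have "summable (\<lambda>n. c n * of_real ((1 + x) / 2) ^ n)"
      by (rule sums_summable[OF s]) (use x in \<open>simp del: of_real_divide of_real_add\<close>)
    then have "summable (\<lambda>n. norm (c n * of_real x ^ n))"
      by (rule powser_insidea) (use x in \<open>simp del: of_real_divide of_real_add\<close>)
    then show ?thesis using x by (simp add: norm_mult norm_power)
  qed
qed

text \<open>On the circle the Taylor polynomials are dominated by the absolute series at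
  \<open>r\<close>, so Parseval's identity for polynomials passes to the limit.\<close>

lemma integral_mean2_sums:
  assumes f: "f holomorphic_on \<D>" and r: "0 \<le> r" "r < 1"
    and lim: "\<And>z. z \<in> \<D> \<Longrightarrow> (\<lambda>n. partial_sum c n z) \<longlonglongrightarrow> f z"
    and abs: "\<And>x. 0 \<le> x \<Longrightarrow> x < 1 \<Longrightarrow> summable (\<lambda>k. norm (c k) * x ^ k)"
  shows "(\<lambda>k. (norm (c k))\<^sup>2 * r ^ (2 * k)) sums integral_mean2 f r"
proof -
  have "(\<lambda>n. integral_mean2 (partial_sum c n) r) \<longlonglongrightarrow> integral_mean2 f r"
    by (rule circle_mean_norm_tendsto[where B = "\<Sum>k. norm (c k) * r ^ k"])
       (use r f lim abs in \<open>auto intro!: norm_partial_sum_le holomorphic_on_imp_continuous_on holomorphic_intros\<close>)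
  then show ?thesis
    using r by (simp add: integral_mean2_partial_sum sums_def)
qed

text \<open>Each Parseval summand increases with the radius. Hence limits along a single sequence of
  radii tending to 1 control all radii.\<close>

lemma integral_mean2_mono_radius:
  assumes f: "f holomorphic_on \<D>" and r: "0 \<le> r" "r \<le> r'" "r' < 1"
  shows "integral_mean2 f r \<le> integral_mean2 f r'"
proof -
  obtain c where c: "\<And>z. z \<in> \<D> \<Longrightarrow> (\<lambda>n. partial_sum c n z) \<longlonglongrightarrow> f z"
    "\<And>x. 0 \<le> x \<Longrightarrow> x < 1 \<Longrightarrow> summable (\<lambda>k. norm (c k) * x ^ k)"
    using holomorphic_disc_power_series[OF f] by blast
  show ?thesis
    by (rule sums_le[OF _ integral_mean2_sums[OF f _ _ c] integral_mean2_sums[OF f _ _ c]])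
       (use r in \<open>auto intro!: mult_left_mono power_mono\<close>)
qed

text \<open>The radius tends to 1 in finite sums only, so no interchange of limit and infinite sum
  is involved; the bound \<open>B\<close> does not depend on the length.\<close>

lemma hardy2_coefficients:
  assumes f: "f holomorphic_on \<D>" and bdd: "\<And>r. 0 \<le> r \<Longrightarrow> r < 1 \<Longrightarrow> integral_mean2 f r \<le> B"
    and lim: "\<And>z. z \<in> \<D> \<Longrightarrow> (\<lambda>n. partial_sum c n z) \<longlonglongrightarrow> f z"
    and abs: "\<And>x. 0 \<le> x \<Longrightarrow> x < 1 \<Longrightarrow> summable (\<lambda>k. norm (c k) * x ^ k)"
  shows "summable (\<lambda>k. (norm (c k))\<^sup>2)" "(\<Sum>k. (norm (c k))\<^sup>2) \<le> B"
proof -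
  have fin: "(\<Sum>k<n. (norm (c k))\<^sup>2) \<le> B" for n
  proof (rule tendsto_upperbound)
    have "isCont (\<lambda>r. \<Sum>k<n. (norm (c k))\<^sup>2 * r ^ (2 * k)) 1"
      by (intro continuous_intros)
    then have "((\<lambda>r. \<Sum>k<n. (norm (c k))\<^sup>2 * r ^ (2 * k)) \<longlongrightarrow> (\<Sum>k<n. (norm (c k))\<^sup>2)) (at 1)"
      by (simp add: isCont_def)
    then show "((\<lambda>r. \<Sum>k<n. (norm (c k))\<^sup>2 * r ^ (2 * k)) \<longlongrightarrow> (\<Sum>k<n. (norm (c k))\<^sup>2)) (at_left (1::real))"
      by (rule filterlim_mono) (auto simp: at_within_le_at)
    have le: "(\<Sum>k<n. (norm (c k))\<^sup>2 * r ^ (2 * k)) \<le> B" if "0 < r" "r < 1" for r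
    proof -
      note s = integral_mean2_sums[OF f _ _ lim abs, of r]
      have "(\<Sum>k<n. (norm (c k))\<^sup>2 * r ^ (2 * k)) \<le> (\<Sum>k. (norm (c k))\<^sup>2 * r ^ (2 * k))"
        using s that by (intro sum_le_suminf) (auto simp: sums_iff)
      also have "\<dots> = integral_mean2 f r" using s that by (auto simp: sums_iff)
      also have "\<dots> \<le> B" using bdd that by simp
      finally show ?thesis .
    qed
    show "\<forall>\<^sub>F r in at_left (1::real). (\<Sum>k<n. (norm (c k))\<^sup>2 * r ^ (2 * k)) \<le> B"
      using eventually_at_left_real[of 0 "1::real"] by (rule eventually_mono) (use le in auto)
  qed auto
  show "summable (\<lambda>k. (norm (c k))\<^sup>2)"
    by (rule bounded_imp_summable[where B = B])
       (use fin[of "Suc _"] in \<open>auto simp: lessThan_Suc_atMost\<close>)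
  then show "(\<Sum>k. (norm (c k))\<^sup>2) \<le> B"
    by (rule suminf_le_const) (rule fin)
qed

section \<open>The pointwise identity behind the weight\<close>

text \<open>To be read with \<open>u = \<phi> z\<close> and \<open>a = \<phi> 0\<close>. For
  polynomial \<open>q\<close> the \<open>Re\<close> term is harmonic in \<open>z\<close>, and the
  last term carries the factor \<open>1 - (cmod u)\<^sup>2\<close>, which is negligible near the
  circle. What remains is the same quantity for the shorter polynomial \<open>q\<close>.\<close>

lemma weight_identity:
  fixes a u q b :: complex and s :: real
  assumes s: "s = 1 - (cmod a)\<^sup>2" "s > 0" and W: "W = (1 - cnj a * u) / of_real (sqrt s)"
  shows "(cmod (W * (b + u * q)))\<^sup>2 = (cmod (W * q))\<^sup>2
     + Re (of_real ((cmod b)\<^sup>2 / s) * (1 + of_real ((cmod a)\<^sup>2) - 2 * (cnj a * u))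
           + of_real (2 / s) * (cnj b * (1 - cnj a * u) * (u - a) * q))
     + (1 - (cmod u)\<^sup>2) * (2 / s * Re (cnj b * (1 - cnj a * u) * a * q)
           - (cmod b)\<^sup>2 * (cmod a)\<^sup>2 / s - (cmod (W * q))\<^sup>2)"
proof -
  define N where "N = (cmod (1 - cnj a * u))\<^sup>2"
  define P where "P = Re (cnj b * (1 - cnj a * u) * (u - a) * q)"
  define Q where "Q = Re (cnj b * (1 - cnj a * u) * a * q)"
  have W2: "(cmod W)\<^sup>2 = N / s"
    using s(2) by (simp add: W N_def norm_divide power_divide)
  define T where "T = Re (cnj a * u)"
  have N: "N = 1 - 2 * T + (cmod a)\<^sup>2 * (cmod u)\<^sup>2"
    unfolding N_def T_def diff_conv_add_uminus cmod_add_squared by (simp add: norm_mult power_mult_distrib)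
  \<comment> \<open>Since \<open>(1 - a * cnj u) * u = u - a * (cmod u)\<^sup>2\<close>, the
    antiholomorphic factor of \<open>N\<close> becomes the holomorphic \<open>u - a\<close> up to a
    multiple of the defect. The factor \<open>u - a\<close> also makes the cross term vanish at
    \<open>u = a\<close>.\<close>
  have "of_real N * u = (1 - cnj a * u) * ((u - a) + a * of_real (1 - (cmod u)\<^sup>2))"
    unfolding N_def of_real_diff complex_norm_square by (simp add: algebra_simps)
  then have "of_real N * (cnj b * (u * q))
      = cnj b * (1 - cnj a * u) * (u - a) * q + of_real (1 - (cmod u)\<^sup>2) * (cnj b * (1 - cnj a * u) * a * q)"
    by algebra
  then have "Re (of_real N * (cnj b * (u * q))) = P + (1 - (cmod u)\<^sup>2) * Q"
    by (simp only: P_def Q_def plus_complex.simps Re_complex_of_real Im_complex_of_real times_complex.simps)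
  moreover define R where "R = Re (cnj b * (u * q))"
  ultimately have cross: "N * R = P + (1 - (cmod u)\<^sup>2) * Q"
    by simp
  have "(cmod (W * (b + u * q)))\<^sup>2
      = (N * (cmod b)\<^sup>2 + N * ((cmod u)\<^sup>2 * (cmod q)\<^sup>2) + 2 * (N * R)) / s"
    unfolding norm_mult[of W] power_mult_distrib W2 cmod_add_squared norm_mult[of u] R_def[symmetric]
    by (simp add: algebra_simps add_divide_distrib)
  \<comment> \<open>Only this \<open>N\<close> is expanded. The one in front of
    \<open>(cmod q)\<^sup>2\<close> is kept, to be matched with
    \<open>(cmod (W * q))\<^sup>2\<close>.\<close>
  also have "N * (cmod b)\<^sup>2 = (1 - 2 * T + (cmod a)\<^sup>2 * (cmod u)\<^sup>2) * (cmod b)\<^sup>2"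
    using N by simp
  also note cross
  finally have lhs: "(cmod (W * (b + u * q)))\<^sup>2
      = ((1 - 2 * T + (cmod a)\<^sup>2 * (cmod u)\<^sup>2) * (cmod b)\<^sup>2 + N * ((cmod u)\<^sup>2 * (cmod q)\<^sup>2)
         + 2 * (P + (1 - (cmod u)\<^sup>2) * Q)) / s" .
  have Re_eq: "Re (of_real x * (1 + of_real y - 2 * v) + of_real x' * v') = x * (1 + y - 2 * Re v) + x' * Re v'"
    for x y x' v v' by simp
  show ?thesis
    unfolding lhs Re_eq norm_mult[of W q] power_mult_distrib W2
      P_def[symmetric] Q_def[symmetric] T_def[symmetric]
    using s(2) by (simp add: field_simps)
qed

section \<open>Inner self-maps of the disc and their weight\<close>

locale inner_selfmap =
  fixes \<phi> :: "complex \<Rightarrow> complex"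
  assumes inner: "inner_function \<phi>" and maps: "\<phi> \<in> \<D> \<rightarrow> \<D>"
begin

text \<open>The reciprocal of the normalised reproducing kernel of H^2 at the point
  \<open>\<phi> 0\<close>, composed with \<open>\<phi>\<close>.\<close>

definition weight :: "complex \<Rightarrow> complex"
  where "weight z = (1 - cnj (\<phi> 0) * \<phi> z) / of_real (sqrt (1 - (cmod (\<phi> 0))\<^sup>2))"

lemma holomorphic: "\<phi> holomorphic_on \<D>"
  using inner by (simp add: inner_function_def)

lemma norm_less_1: "z \<in> \<D> \<Longrightarrow> cmod (\<phi> z) < 1"
  using maps by (auto simp: Pi_iff)

lemma defect_pos: "0 < 1 - (cmod (\<phi> 0))\<^sup>2"
  using norm_less_1[of 0] by (simp add: power_less_one_iff abs_square_less_1)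

lemma holomorphic_weight: "weight holomorphic_on \<D>"
  unfolding weight_def using defect_pos by (intro holomorphic_intros holomorphic) auto

lemma norm_weight_le:
  assumes "z \<in> \<D>"
  shows "cmod (weight z) \<le> 2 / sqrt (1 - (cmod (\<phi> 0))\<^sup>2)"
proof -
  have "cmod (1 - cnj (\<phi> 0) * \<phi> z) \<le> 1 + cmod (\<phi> 0) * cmod (\<phi> z)"
    by (rule order_trans[OF norm_triangle_ineq4]) (simp add: norm_mult)
  also have "\<dots> \<le> 2"
    using norm_less_1[OF assms] norm_less_1[of 0] mult_le_one[of "cmod (\<phi> 0)" "cmod (\<phi> z)"] by simp
  finally show ?thesis
    using defect_pos by (simp add: weight_def norm_divide divide_right_mono)
qed

text \<open>A sequence of radii, because dominated convergence is applied to sequences; it starts at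
  0 and increases to 1.\<close>

abbreviation radius :: "nat \<Rightarrow> real"
  where "radius i \<equiv> 1 - inverse (real (Suc i))"

lemma radius: "0 \<le> radius i" "radius i < 1"
  by (auto simp: field_simps)

lemma radius_tendsto: "radius \<longlonglongrightarrow> 1"
  using tendsto_diff[OF tendsto_const LIMSEQ_inverse_real_of_nat, of "1::real"] by simp

text \<open>This is where the unimodular boundary values enter: the defect tends to 0 along almost
  every radius and stays between 0 and 1.\<close>

lemma circle_mean_defect_tendsto:
  "(\<lambda>i. circle_mean (\<lambda>z. 1 - (cmod (\<phi> z))\<^sup>2) (radius i)) \<longlonglongrightarrow> 0"
proof -
  have lim: "filterlim radius (at_left 1) sequentially"
    using radius_tendsto radius(2) by (auto simp: filterlim_at)
  have "AE t in lebesgue_on {0..2*pi}.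
      \<exists>l. ((\<lambda>r. \<phi> (of_real r * cis t)) \<longlongrightarrow> l) (at_left 1) \<and> cmod l = 1"
    using inner by (simp add: inner_function_def)
  then have ae: "AE t in lebesgue_on {0..2*pi}.
      (\<lambda>i. 1 - (cmod (\<phi> (of_real (radius i) * cis t)))\<^sup>2) \<longlonglongrightarrow> 0"
  proof (rule eventually_mono)
    fix t assume "\<exists>l. ((\<lambda>r. \<phi> (of_real r * cis t)) \<longlongrightarrow> l) (at_left 1) \<and> cmod l = 1"
    then obtain l where l: "((\<lambda>r. \<phi> (of_real r * cis t)) \<longlongrightarrow> l) (at_left 1)" "cmod l = 1" by blast
    have "(\<lambda>i. \<phi> (of_real (radius i) * cis t)) \<longlonglongrightarrow> l"
      by (rule filterlim_compose[OF l(1) lim])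
    then have "(\<lambda>i. 1 - (cmod (\<phi> (of_real (radius i) * cis t)))\<^sup>2) \<longlonglongrightarrow> 1 - (cmod l)\<^sup>2"
      by (intro tendsto_intros)
    then show "(\<lambda>i. 1 - (cmod (\<phi> (of_real (radius i) * cis t)))\<^sup>2) \<longlonglongrightarrow> 0"
      using l by simp
  qed
  \<comment> \<open>The limit is phrased as the mean of the zero function over the degenerate
    circle, since \<open>circle_mean_tendsto\<close> wants a limit circle of radius less than
    1.\<close>
  have "(\<lambda>i. circle_mean (\<lambda>z. 1 - (cmod (\<phi> z))\<^sup>2) (radius i)) \<longlonglongrightarrow> circle_mean (\<lambda>_. 0) 0"
  proof (rule circle_mean_tendsto[where B = 1])
    show "continuous_on \<D> (\<lambda>z. 1 - (cmod (\<phi> z))\<^sup>2)"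
      by (intro continuous_intros holomorphic_on_imp_continuous_on holomorphic)
    show "\<bar>1 - (cmod (\<phi> (of_real (radius i) * cis t)))\<^sup>2\<bar> \<le> 1" for i t
      using norm_less_1[OF circle_in_disc[OF radius, of i t]] by (simp add: power_le_one)
  qed (use ae radius in auto)
  then show ?thesis by (simp add: circle_mean_const)
qed

section \<open>The norm identity for polynomials\<close>

lemma integral_mean2_weight_partial_sum_tendsto:
  "(\<lambda>i. integral_mean2 (\<lambda>z. weight z * partial_sum c n (\<phi> z)) (radius i))
     \<longlonglongrightarrow> (\<Sum>k<n. (cmod (c k))\<^sup>2)"
proof (induction n arbitrary: c)
  case 0
  then show ?case by (simp add: integral_mean2_def)
next
  case (Suc n)
  define a s b where "a = \<phi> 0" and "s = 1 - (cmod a)\<^sup>2" and "b = c 0"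
  define q where "q = partial_sum (c \<circ> Suc) n"
  define h where "h z = of_real ((cmod b)\<^sup>2 / s) * (1 + of_real ((cmod a)\<^sup>2) - 2 * (cnj a * \<phi> z))
           + of_real (2 / s) * (cnj b * (1 - cnj a * \<phi> z) * (\<phi> z - a) * q (\<phi> z))" for z
  \<comment> \<open>The cofactor of the defect in \<open>weight_identity\<close>. As a function of
    \<open>u\<close> it is continuous on the closed disc, so compactness bounds
    \<open>E (\<phi> z)\<close> uniformly in \<open>z\<close>.\<close>
  define E where "E u = 2 / s * Re (cnj b * (1 - cnj a * u) * a * q u)
           - (cmod b)\<^sup>2 * (cmod a)\<^sup>2 / s - (cmod ((1 - cnj a * u) / of_real (sqrt s) * q u))\<^sup>2" for u
  let ?d = "\<lambda>z. 1 - (cmod (\<phi> z))\<^sup>2"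
  have s: "s > 0" using defect_pos by (simp add: s_def a_def)
  have q_hol: "(\<lambda>z. q (f z)) holomorphic_on A" if "f holomorphic_on A" for f A
    unfolding q_def using that by (rule holomorphic_on_partial_sum)
  have q_cont: "continuous_on A q" for A
    using q_hol[of "\<lambda>z. z"] by (intro holomorphic_on_imp_continuous_on) simp
  have E_cont: "continuous_on A E" for A
    unfolding E_def using s by (intro continuous_intros q_cont) auto
  have "bounded (E ` cball 0 1)"
    by (intro compact_imp_bounded compact_continuous_image E_cont compact_cball)
  then obtain B where "\<And>u. cmod u \<le> 1 \<Longrightarrow> \<bar>E u\<bar> \<le> B"
    unfolding bounded_iff by fastforce
  then have B: "\<bar>E (\<phi> z)\<bar> \<le> B" if "z \<in> \<D>" for z
    using norm_less_1[OF that] by simp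
  have h: "h holomorphic_on \<D>"
    unfolding h_def by (intro holomorphic_intros q_hol holomorphic)
  \<comment> \<open>At 0 the factor \<open>\<phi> z - a\<close> kills the second summand of
    \<open>h\<close>, and the first bracket becomes \<open>1 - (cmod a)\<^sup>2\<close>, which
    cancels the denominator \<open>s\<close>.\<close>
  have h0: "h 0 = of_real ((cmod b)\<^sup>2)"
  proof -
    have "h 0 = of_real ((cmod b)\<^sup>2 / s) * (1 + of_real ((cmod a)\<^sup>2) - 2 * (cnj a * a))"
      by (simp add: h_def a_def)
    also have "1 + of_real ((cmod a)\<^sup>2) - 2 * (cnj a * a) = of_real s"
      unfolding s_def of_real_diff complex_norm_square by simp
    finally show ?thesis using s by simp
  qed
  have eq: "(cmod (weight z * partial_sum c (Suc n) (\<phi> z)))\<^sup>2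
      = (cmod (weight z * q (\<phi> z)))\<^sup>2 + Re (h z) + ?d z * E (\<phi> z)" for z
    unfolding partial_sum_Suc h_def E_def q_def[symmetric] b_def[symmetric]
    using weight_identity[OF s_def s, of "weight z" "\<phi> z" b "q (\<phi> z)"]
    by (simp add: weight_def a_def s_def)
  have d_cont: "continuous_on \<D> ?d"
    by (intro continuous_intros holomorphic_on_imp_continuous_on holomorphic)
  have h_cont: "continuous_on \<D> (\<lambda>z. Re (h z))"
    by (intro continuous_intros holomorphic_on_imp_continuous_on h)
  have w_cont: "continuous_on \<D> (\<lambda>z. (cmod (weight z * q (\<phi> z)))\<^sup>2)"
    by (intro continuous_intros holomorphic_on_imp_continuous_on q_hol holomorphic holomorphic_weight)
  have E\<phi>_cont: "continuous_on \<D> (\<lambda>z. E (\<phi> z))"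
    by (intro continuous_on_compose2[OF E_cont[of UNIV]] holomorphic_on_imp_continuous_on holomorphic) auto
  have mean: "integral_mean2 (\<lambda>z. weight z * partial_sum c (Suc n) (\<phi> z)) (radius i)
      = integral_mean2 (\<lambda>z. weight z * q (\<phi> z)) (radius i) + (cmod b)\<^sup>2
        + circle_mean (\<lambda>z. ?d z * E (\<phi> z)) (radius i)" for i
    unfolding integral_mean2_eq_circle_mean eq
    using circle_mean_Re_holomorphic[OF h radius] h0 radius
    by (simp add: circle_mean_add continuous_on_add continuous_on_mult d_cont h_cont w_cont E\<phi>_cont
        del: of_nat_Suc)
  have error: "(\<lambda>i. circle_mean (\<lambda>z. ?d z * E (\<phi> z)) (radius i)) \<longlonglongrightarrow> 0"
  proof (rule tendsto_sandwich)
    have "?d z * E (\<phi> z) \<le> B * ?d z" "- B * ?d z \<le> ?d z * E (\<phi> z)" if "z \<in> \<D>" for z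
    proof -
      have d: "0 \<le> ?d z" using norm_less_1[OF that] by (simp add: power_le_one)
      show "?d z * E (\<phi> z) \<le> B * ?d z"
        using mult_right_mono[OF _ d, of "E (\<phi> z)" B] B[OF that] by (simp add: mult.commute)
      show "- B * ?d z \<le> ?d z * E (\<phi> z)"
        using mult_right_mono[OF _ d, of "- B" "E (\<phi> z)"] B[OF that] by (simp add: mult.commute)
    qed
    then show "\<forall>\<^sub>F i in sequentially. circle_mean (\<lambda>z. ?d z * E (\<phi> z)) (radius i) \<le> B * circle_mean ?d (radius i)"
      and "\<forall>\<^sub>F i in sequentially. - B * circle_mean ?d (radius i) \<le> circle_mean (\<lambda>z. ?d z * E (\<phi> z)) (radius i)"
      unfolding circle_mean_cmult[symmetric]
      by (intro always_eventually allI circle_mean_mono radius continuous_on_mult continuous_on_const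
          d_cont E\<phi>_cont; simp)+
  qed (intro tendsto_mult_right_zero circle_mean_defect_tendsto)+
  have "(\<lambda>i. integral_mean2 (\<lambda>z. weight z * partial_sum c (Suc n) (\<phi> z)) (radius i))
      \<longlonglongrightarrow> (\<Sum>k<n. (cmod ((c \<circ> Suc) k))\<^sup>2) + (cmod b)\<^sup>2 + 0"
    unfolding mean by (intro tendsto_add tendsto_const error Suc.IH[of "c \<circ> Suc", folded q_def])
  then show ?case
    by (subst sum.lessThan_Suc_shift) (simp add: b_def add.commute)
qed

text \<open>The means increase with the radius, so each of them lies below the limit just
  computed.\<close>

lemma integral_mean2_weight_partial_sum_le:
  assumes r: "0 \<le> r" "r < 1"
  shows "integral_mean2 (\<lambda>z. weight z * partial_sum c n (\<phi> z)) r \<le> (\<Sum>k<n. (cmod (c k))\<^sup>2)"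
proof (rule tendsto_lowerbound[OF integral_mean2_weight_partial_sum_tendsto])
  have "\<forall>\<^sub>F i in sequentially. r < radius i"
    using radius_tendsto r(2) by (rule order_tendstoD)
  then show "\<forall>\<^sub>F i in sequentially. integral_mean2 (\<lambda>z. weight z * partial_sum c n (\<phi> z)) r
      \<le> integral_mean2 (\<lambda>z. weight z * partial_sum c n (\<phi> z)) (radius i)"
    by (rule eventually_mono)
       (auto intro!: integral_mean2_mono_radius holomorphic_intros holomorphic holomorphic_weight r radius
          simp del: of_nat_Suc)
qed simp

section \<open>From polynomials to arbitrary functions\<close>

lemma holomorphic_weighted_comp:
  "f holomorphic_on \<D> \<Longrightarrow> (\<lambda>z. weight z * f (\<phi> z)) holomorphic_on \<D>"
  using holomorphic_on_compose_gen[OF holomorphic, of f \<D>] maps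
  by (intro holomorphic_intros holomorphic_weight) (simp add: o_def image_subset_iff_funcset)

lemma integral_mean2_weighted_comp_le:
  assumes f: "f holomorphic_on \<D>" and r: "0 \<le> r" "r < 1"
    and lim: "\<And>z. z \<in> \<D> \<Longrightarrow> (\<lambda>n. partial_sum c n z) \<longlonglongrightarrow> f z"
    and abs: "\<And>x. 0 \<le> x \<Longrightarrow> x < 1 \<Longrightarrow> summable (\<lambda>k. norm (c k) * x ^ k)"
    and c: "(\<lambda>k. (cmod (c k))\<^sup>2) sums S"
  shows "integral_mean2 (\<lambda>z. weight z * f (\<phi> z)) r \<le> S"
proof -
  have sub: "sphere 0 r \<subseteq> \<D>" using r by auto
  \<comment> \<open>The image of the circle under \<open>\<phi>\<close> stays in a disc of radius
    \<open>cmod (\<phi> x) < 1\<close>, where the Taylor polynomials of \<open>f\<close> are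
    uniformly bounded; this supplies the dominating constant \<open>M\<close>.\<close>
  have "\<exists>x\<in>sphere 0 r. \<forall>y\<in>sphere 0 r. cmod (\<phi> y) \<le> cmod (\<phi> x)"
    by (intro continuous_attains_sup continuous_intros holomorphic_on_imp_continuous_on
        holomorphic_on_subset[OF holomorphic sub]) (use r in auto)
  then obtain x where x: "x \<in> sphere 0 r" "\<And>y. y \<in> sphere 0 r \<Longrightarrow> cmod (\<phi> y) \<le> cmod (\<phi> x)" by blast
  then have x1: "cmod (\<phi> x) < 1" using norm_less_1 sub by blast
  define M where "M = 2 / sqrt (1 - (cmod (\<phi> 0))\<^sup>2) * (\<Sum>k. cmod (c k) * cmod (\<phi> x) ^ k)"
  have "(\<lambda>n. integral_mean2 (\<lambda>z. weight z * partial_sum c n (\<phi> z)) r)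
      \<longlonglongrightarrow> integral_mean2 (\<lambda>z. weight z * f (\<phi> z)) r"
  proof (rule circle_mean_norm_tendsto[where B = M, OF _ _ r])
    show "continuous_on \<D> (\<lambda>z. weight z * partial_sum c n (\<phi> z))" for n
      by (intro holomorphic_on_imp_continuous_on holomorphic_intros holomorphic holomorphic_weight)
    show "continuous_on \<D> (\<lambda>z. weight z * f (\<phi> z))"
      by (intro holomorphic_on_imp_continuous_on holomorphic_weighted_comp f)
    fix z :: complex assume z: "cmod z = r"
    then have zD: "z \<in> \<D>" using r by simp
    show "cmod (weight z * partial_sum c n (\<phi> z)) \<le> M" for n
      unfolding norm_mult M_def
      by (intro mult_mono norm_weight_le norm_partial_sum_le abs x1 x(2) zD) (use z defect_pos in auto)
    show "(\<lambda>n. weight z * partial_sum c n (\<phi> z)) \<longlonglongrightarrow> weight z * f (\<phi> z)"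
      by (intro tendsto_intros lim) (use norm_less_1[OF zD] in simp)
  qed
  moreover have "integral_mean2 (\<lambda>z. weight z * partial_sum c n (\<phi> z)) r \<le> S" for n
    using integral_mean2_weight_partial_sum_le[OF r, of c n] sum_le_suminf[of "\<lambda>k. (cmod (c k))\<^sup>2" "{..<n}"] c
    by (auto simp: sums_iff)
  ultimately show ?thesis
    by (intro LIMSEQ_le_const2) auto
qed

text \<open>The Taylor polynomial is \<open>f\<close> minus its remainder. The image of the
  remainder has means at most the coefficient tail by the upper estimate, and the means of the
  polynomial's image tend to \<open>Sn n\<close>, so \<open>Sn n\<close> is bounded by
  \<open>B\<close> up to small errors.\<close>

lemma integral_mean2_weighted_comp_ge:
  assumes f: "f holomorphic_on \<D>"
    and lim: "\<And>z. z \<in> \<D> \<Longrightarrow> (\<lambda>n. partial_sum c n z) \<longlonglongrightarrow> f z"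
    and abs: "\<And>x. 0 \<le> x \<Longrightarrow> x < 1 \<Longrightarrow> summable (\<lambda>k. norm (c k) * x ^ k)"
    and c: "(\<lambda>k. (cmod (c k))\<^sup>2) sums S"
    and B: "\<And>r. 0 \<le> r \<Longrightarrow> r < 1 \<Longrightarrow> integral_mean2 (\<lambda>z. weight z * f (\<phi> z)) r \<le> B"
  shows "S \<le> B"
proof (rule field_le_epsilon)
  fix e :: real assume "0 < e"
  have B0: "0 \<le> B"
    by (rule order_trans[OF _ B[of 0]]) (simp_all add: integral_mean2_def)
  \<comment> \<open>Makes \<open>\<epsilon> * B\<close> at most \<open>e\<close>; the summand 1
    avoids division by zero when \<open>B = 0\<close>.\<close>
  define \<epsilon> where "\<epsilon> = e / (B + 1)"
  have \<epsilon>: "\<epsilon> > 0" using \<open>0 < e\<close> B0 by (simp add: \<epsilon>_def)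
  define Sn where "Sn n = (\<Sum>k<n. (cmod (c k))\<^sup>2)" for n
  have Sn: "Sn \<longlonglongrightarrow> S" using c by (simp add: sums_def Sn_def[abs_def])
  have bound: "Sn n \<le> (1 + \<epsilon>) * B + (1 + 1 / \<epsilon>) * (S - Sn n)" for n
  proof (rule tendsto_upperbound[OF integral_mean2_weight_partial_sum_tendsto[of c n, folded Sn_def]])
    define g where "g z = f z - partial_sum c n z" for z
    \<comment> \<open>The Taylor coefficients of the remainder \<open>g\<close>: its partial sums
      agree with those of \<open>c\<close> minus the first \<open>n\<close> terms once
      \<open>m\<close> is at least \<open>n\<close>.\<close>
    define d where "d k = (if k < n then 0 else c k)" for k
    have g: "g holomorphic_on \<D>"
      unfolding g_def by (intro holomorphic_intros f)
    have d_lim: "(\<lambda>m. partial_sum d m z) \<longlonglongrightarrow> g z" if "z \<in> \<D>" for z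
    proof (rule Lim_transform_eventually)
      show "(\<lambda>m. partial_sum c m z - partial_sum c n z) \<longlonglongrightarrow> g z"
        unfolding g_def by (intro tendsto_intros lim that)
      have "partial_sum c m z - partial_sum c n z = partial_sum d m z" if "n \<le> m" for m
      proof -
        have "{..<m} = {..<n} \<union> {n..<m}" using that by auto
        then show ?thesis
          by (simp add: partial_sum_def d_def sum.union_disjoint ivl_disj_int)
      qed
      then show "\<forall>\<^sub>F m in sequentially. partial_sum c m z - partial_sum c n z = partial_sum d m z"
        by (rule eventually_sequentiallyI)
    qed
    have d_abs: "summable (\<lambda>k. cmod (d k) * x ^ k)" if "0 \<le> x" "x < 1" for x
      by (rule summable_comparison_test'[OF abs[OF that], of 0]) (use that in \<open>simp add: d_def\<close>)
    have "(\<lambda>k. (cmod (c k))\<^sup>2 - (if k \<in> {..<n} then (cmod (c k))\<^sup>2 else 0)) sums (S - Sn n)"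
      unfolding Sn_def by (intro sums_diff c sums_If_finite_set) simp
    also have "(\<lambda>k. (cmod (c k))\<^sup>2 - (if k \<in> {..<n} then (cmod (c k))\<^sup>2 else 0)) = (\<lambda>k. (cmod (d k))\<^sup>2)"
      by (auto simp: d_def)
    finally have d: "(\<lambda>k. (cmod (d k))\<^sup>2) sums (S - Sn n)" .
    have cont: "continuous_on \<D> (\<lambda>z. weight z * f (\<phi> z))" "continuous_on \<D> (\<lambda>z. weight z * g (\<phi> z))"
      "continuous_on \<D> (\<lambda>z. weight z * partial_sum c n (\<phi> z))"
      by (intro holomorphic_on_imp_continuous_on holomorphic_weighted_comp f g holomorphic_intros
          holomorphic holomorphic_weight)+
    have split: "(cmod (weight z * partial_sum c n (\<phi> z)))\<^sup>2
        \<le> (1 + \<epsilon>) * (cmod (weight z * f (\<phi> z)))\<^sup>2 + (1 + 1 / \<epsilon>) * (cmod (weight z * g (\<phi> z)))\<^sup>2" for z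
      using cmod_diff_squared_le[OF \<epsilon>, of "weight z * f (\<phi> z)" "weight z * g (\<phi> z)"]
      by (simp add: g_def algebra_simps)
    have "integral_mean2 (\<lambda>z. weight z * partial_sum c n (\<phi> z)) (radius i)
        \<le> (1 + \<epsilon>) * B + (1 + 1 / \<epsilon>) * (S - Sn n)" for i
    proof -
      let ?r = "radius i"
      have "integral_mean2 (\<lambda>z. weight z * partial_sum c n (\<phi> z)) ?r
          \<le> circle_mean (\<lambda>z. (1 + \<epsilon>) * (cmod (weight z * f (\<phi> z)))\<^sup>2
              + (1 + 1 / \<epsilon>) * (cmod (weight z * g (\<phi> z)))\<^sup>2) ?r"
        unfolding integral_mean2_eq_circle_mean
        by (rule circle_mean_mono[OF _ _ radius split]) (intro continuous_intros cont)+
      also have "\<dots> = (1 + \<epsilon>) * integral_mean2 (\<lambda>z. weight z * f (\<phi> z)) ?r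
          + (1 + 1 / \<epsilon>) * integral_mean2 (\<lambda>z. weight z * g (\<phi> z)) ?r"
        unfolding integral_mean2_eq_circle_mean circle_mean_cmult[symmetric]
        by (rule circle_mean_add[OF _ _ radius]) (intro continuous_intros cont)+
      also have "\<dots> \<le> (1 + \<epsilon>) * B + (1 + 1 / \<epsilon>) * (S - Sn n)"
        by (intro add_mono mult_left_mono B radius integral_mean2_weighted_comp_le[OF g _ _ d_lim d_abs d])
           (use \<epsilon> in auto)
      finally show ?thesis .
    qed
    then show "\<forall>\<^sub>F i in sequentially. integral_mean2 (\<lambda>z. weight z * partial_sum c n (\<phi> z)) (radius i)
        \<le> (1 + \<epsilon>) * B + (1 + 1 / \<epsilon>) * (S - Sn n)"
      by (rule always_eventually[OF allI])
  qed simp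
  \<comment> \<open>With \<open>\<epsilon>\<close> fixed, \<open>n\<close> tends to infinity, so the
    tail vanishes however large \<open>1 + 1 / \<epsilon>\<close> is.\<close>
  have "S \<le> (1 + \<epsilon>) * B + (1 + 1 / \<epsilon>) * (S - S)"
  proof (rule LIMSEQ_le[OF Sn])
    show "(\<lambda>n. (1 + \<epsilon>) * B + (1 + 1 / \<epsilon>) * (S - Sn n))
        \<longlonglongrightarrow> (1 + \<epsilon>) * B + (1 + 1 / \<epsilon>) * (S - S)"
      by (intro tendsto_intros Sn)
  qed (use bound in blast)
  also have "\<dots> = B + e * (B / (B + 1))"
    by (simp add: \<epsilon>_def algebra_simps)
  also have "\<dots> \<le> B + e"
    using B0 \<open>0 < e\<close> by (intro add_left_mono mult_left_le) (auto simp: divide_simps)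
  finally show "S \<le> B + e" .
qed

section \<open>Membership of the weight and the isometry\<close>

lemma weight_in_hardy2: "weight \<in> hardy2"
  unfolding hardy2_def
proof (intro CollectI conjI holomorphic_weight bdd_aboveI2)
  fix r :: real assume "r \<in> {0..<1}"
  then show "integral_mean2 weight r \<le> 1"
    \<comment> \<open>The weight is the image of the constant polynomial 1.\<close>
    using integral_mean2_weight_partial_sum_le[of r "\<lambda>_. 1" 1] by (simp add: partial_sum_def)
qed

text \<open>Both suprema equal the sum \<open>S\<close> of the squared moduli of the Taylor
  coefficients of \<open>f\<close>.\<close>

lemma hardy2_weighted_comp:
  assumes "f \<in> hardy2"
  shows "weighted_comp weight \<phi> f \<in> hardy2" "hardy2_norm (weighted_comp weight \<phi> f) = hardy2_norm f"
proof -
  have f: "f holomorphic_on \<D>" and bdd: "bdd_above (integral_mean2 f ` {0..<1})"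
    using assms by (auto simp: hardy2_def)
  obtain c where c: "\<And>z. z \<in> \<D> \<Longrightarrow> (\<lambda>n. partial_sum c n z) \<longlonglongrightarrow> f z"
    "\<And>x. 0 \<le> x \<Longrightarrow> x < 1 \<Longrightarrow> summable (\<lambda>k. norm (c k) * x ^ k)"
    using holomorphic_disc_power_series[OF f] by blast
  obtain B where "\<And>r. 0 \<le> r \<Longrightarrow> r < 1 \<Longrightarrow> integral_mean2 f r \<le> B"
    using bdd unfolding bdd_above_def by fastforce
  from hardy2_coefficients(1)[OF f this c]
  have summable: "summable (\<lambda>k. (cmod (c k))\<^sup>2)" by blast
  define S where "S = (\<Sum>k. (cmod (c k))\<^sup>2)"
  have S: "(\<lambda>k. (cmod (c k))\<^sup>2) sums S"
    using summable by (simp add: S_def summable_sums)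
  have le: "integral_mean2 (weighted_comp weight \<phi> f) r \<le> S" if "0 \<le> r" "r < 1" for r
    unfolding weighted_comp_def by (rule integral_mean2_weighted_comp_le[OF f that c S])
  show "weighted_comp weight \<phi> f \<in> hardy2"
    using le holomorphic_weighted_comp[OF f]
    by (auto simp: hardy2_def weighted_comp_def intro!: bdd_aboveI2[where M = S])
  have "(SUP r\<in>{0..<1}. integral_mean2 (weighted_comp weight \<phi> f) r) = S"
  proof (rule cSup_eq_non_empty)
    fix B assume "\<And>x. x \<in> integral_mean2 (weighted_comp weight \<phi> f) ` {0..<1} \<Longrightarrow> x \<le> B"
    then show "S \<le> B"
      by (intro integral_mean2_weighted_comp_ge[OF f c S]) (auto simp: weighted_comp_def)
  qed (use le in auto)
  moreover have "(SUP r\<in>{0..<1}. integral_mean2 f r) = S"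
  proof (rule cSup_eq_non_empty)
    fix x assume "x \<in> integral_mean2 f ` {0..<1}"
    then obtain r where r: "0 \<le> r" "r < 1" "x = integral_mean2 f r" by auto
    have "(cmod (c k))\<^sup>2 * r ^ (2 * k) \<le> (cmod (c k))\<^sup>2" for k
      using r by (simp add: mult_left_le power_le_one)
    then show "x \<le> S"
      unfolding r(3) by (rule sums_le[OF _ integral_mean2_sums[OF f r(1,2) c] S])
  next
    fix B assume "\<And>x. x \<in> integral_mean2 f ` {0..<1} \<Longrightarrow> x \<le> B"
    then show "S \<le> B"
      unfolding S_def by (intro hardy2_coefficients(2)[OF f _ c]) auto
  qed auto
  ultimately show "hardy2_norm (weighted_comp weight \<phi> f) = hardy2_norm f"
    by (simp add: hardy2_norm_def)
qed

end

theorem proposition4p2: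
  fixes \<phi> :: "complex \<Rightarrow> complex"
  assumes "inner_function \<phi>" and "\<phi> \<in> \<D> \<rightarrow> \<D>"
  shows "\<exists>w\<in>hardy2. hardy2_isometry (weighted_comp w \<phi>)"
proof -
  interpret inner_selfmap \<phi> by unfold_locales fact+
  have "hardy2_isometry (weighted_comp weight \<phi>)"
    using hardy2_weighted_comp
    by (auto simp: hardy2_isometry_def) (simp_all add: weighted_comp_def algebra_simps)
  then show ?thesis using weight_in_hardy2 by blast
qed

end
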